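(* Let $\pi_1,\pi_2$ be possibility distributions on a finite set $\mathcal{X}$, with induced possibility measures $\Pi_1,\Pi_2$, and let $\overline{P}(A)=\min\{\Pi_1(A),\Pi_2(A)\}$ for all $A\subseteq\mathcal{X}$. Then $\overline{P}$ is a possibility measure if and only if $$\min_{i\in\{1,2\}}\Big(\max_{j\in\{1,2\}}\pi_i(x_j)\Big)=\max_{j\in\{1,2\}}\Big(\min_{i\in\{1,2\}}\pi_i(x_j)\Big)$$ for all $\{x_1,x_2\}\subseteq\mathcal{X}$. In such a case, the natural extension $\overline{E}$ of $\overline{P}$ coincides with $\overline{P}$, and hence $\overline{E}$ is a possibility measure as well.
   Context: $\mathcal{X}$ is a finite set and $\wp(\mathcal{X})$ its power set. A possibility distribution on $\mathcal{X}$ is a function $\pi\colon\mathcal{X}\to[0,1]$ with $\max_{x\in\mathcal{X}}\pi(x)=1$. It induces the possibility measure $\Pi\colon\wp(\mathcal{X})\to[0,1]$, $\Pi(A)=\max_{x\in A}\pi(x)$, with $\Pi(\emptyset)=0$. A set function is called a possibility measure if it is induced in this way by some possibility distribution. An upper probability is a function $\overline{P}\colon\wp(\mathcal{X})\to[0,1]$. Its credal set $\mathcal{M}$ is the set of all (finitely additive) probability measures $Q$ on $\wp(\mathcal{X})$ with $Q(A)\le\overline{P}(A)$ for all $A\subseteq\mathcal{X}$. $\overline{P}$ avoids sure loss if $\mathcal{M}\neq\emptyset$; in that case its natural extension is $\overline{E}(A)=\max_{Q\in\mathcal{M}}Q(A)$ for $A\subseteq\mathcal{X}$. The assertion that $\overline{E}$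 coincides with $\overline{P}$ includes that $\overline{P}$ avoids sure loss, so that $\overline{E}$ exists. *)

theory Defs
  imports "HOL-Analysis.Analysis"
begin

text \<open>
  The finite space is a carrier set \<open>X\<close>. Set functions on the power set of \<open>X\<close> are total
  functions \<open>'a set \<Rightarrow> real\<close> of which only the values on subsets of \<open>X\<close> matter.
\<close>

text \<open>\<open>X \<noteq> {}\<close> is explicit because \<^const>\<open>Max\<close> is unspecified on the empty set.\<close>

definition possibility_distribution :: "'a set \<Rightarrow> ('a \<Rightarrow> real) \<Rightarrow> bool" where
  "possibility_distribution X \<pi> \<longleftrightarrow>
     X \<noteq> {} \<and> (\<forall>x\<in>X. \<pi> x \<in> {0..1}) \<and> Max (\<pi> ` X) = 1"

definition induced_possibility :: "('a \<Rightarrow> real) \<Rightarrow> 'a set \<Rightarrow> real" where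
  "induced_possibility \<pi> A = (if A = {} then 0 else Max (\<pi> ` A))"

definition possibility_measure :: "'a set \<Rightarrow> ('a set \<Rightarrow> real) \<Rightarrow> bool" where
  "possibility_measure X P \<longleftrightarrow>
     (\<exists>\<pi>. possibility_distribution X \<pi> \<and> (\<forall>A\<subseteq>X. P A = induced_possibility \<pi> A))"

definition finitely_additive_probability :: "'a set \<Rightarrow> ('a set \<Rightarrow> real) \<Rightarrow> bool" where
  "finitely_additive_probability X Q \<longleftrightarrow>
     (\<forall>A\<subseteq>X. Q A \<in> {0..1}) \<and> Q X = 1 \<and> additive (Pow X) Q"

definition credal_set :: "'a set \<Rightarrow> ('a set \<Rightarrow> real) \<Rightarrow> ('a set \<Rightarrow> real) set" where
  "credal_set X P = {Q. finitely_additive_probability X Q \<and> (\<forall>A\<subseteq>X. Q A \<le> P A)}"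

definition avoids_sure_loss :: "'a set \<Rightarrow> ('a set \<Rightarrow> real) \<Rightarrow> bool" where
  "avoids_sure_loss X P \<longleftrightarrow> credal_set X P \<noteq> {}"

text \<open>
  The maximum ranges over a set that is infinite in general, hence \<^const>\<open>Greatest\<close> rather
  than \<^const>\<open>Max\<close>; it is attained whenever \<open>P\<close> avoids sure loss, see
  \<open>natural_extension_attained\<close> below.
\<close>

definition natural_extension :: "'a set \<Rightarrow> ('a set \<Rightarrow> real) \<Rightarrow> 'a set \<Rightarrow> real" where
  "natural_extension X P A = (GREATEST r. r \<in> (\<lambda>Q. Q A) ` credal_set X P)"

lemma natural_extension_attained:
  assumes "avoids_sure_loss X P" and "A \<subseteq> X"
  shows "\<exists>Q\<in>credal_set X P. Q A = natural_extension X P A"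
    and "\<And>Q. Q \<in> credal_set X P \<Longrightarrow> Q A \<le> natural_extension X P A"
proof -
  define K where "K = {Q::'a set \<Rightarrow> real. \<forall>B. Q B \<in> {0..1}}"
  define M where "M = credal_set X P \<inter> K"
  have K: "compact K"
  proof -
    have "compactin (product_topology (\<lambda>i::'a set. euclidean) UNIV) (PiE UNIV (\<lambda>_. {0..1::real}))"
      by (subst compactin_PiE) auto
    moreover have "PiE UNIV (\<lambda>_. {0..1::real}) = K" by (auto simp: K_def PiE_def)
    ultimately show ?thesis by (simp add: euclidean_product_topology)
  qed
  have ev: "continuous_on UNIV (\<lambda>Q::'a set \<Rightarrow> real. Q B)" for B
    by (rule continuous_on_product_coordinates)
  have "closed (credal_set X P)"
    unfolding credal_set_def finitely_additive_probability_def additive_def atLeastAtMost_iff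
      Ball_def
    by (intro closed_Collect_conj closed_Collect_all closed_Collect_imp closed_Collect_le
      closed_Collect_eq open_Collect_const continuous_on_add continuous_on_const ev)
  then have M: "compact M" using K by (simp add: M_def closed_Int_compact)
  have trunc: "(\<lambda>B. if B \<subseteq> X then Q B else 0) \<in> M" if "Q \<in> credal_set X P" for Q
    using that
    by (auto simp: M_def K_def credal_set_def finitely_additive_probability_def additive_def)
  have ne: "M \<noteq> {}" using assms(1) trunc unfolding avoids_sure_loss_def by blast
  obtain Q0 where Q0: "Q0 \<in> M" "\<And>Q. Q \<in> M \<Longrightarrow> Q A \<le> Q0 A"
    using continuous_attains_sup[OF M ne continuous_on_subset[OF ev]] by blast
  have le: "Q A \<le> Q0 A" if "Q \<in> credal_set X P" for Q
    using Q0(2)[OF trunc[OF that]] assms(2) by simp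
  have Q0c: "Q0 \<in> credal_set X P" using Q0(1) by (simp add: M_def)
  have "natural_extension X P A = Q0 A"
    unfolding natural_extension_def by (rule Greatest_equality) (use Q0c le in auto)
  with Q0c le show "\<exists>Q\<in>credal_set X P. Q A = natural_extension X P A"
    and "\<And>Q. Q \<in> credal_set X P \<Longrightarrow> Q A \<le> natural_extension X P A" by auto
qed

end

theory Submission
  imports Defs
begin

text \<open>
  A possibility measure is determined by its values on singletons, so the only candidate
  distribution for \<open>P\<close> is \<open>min (\<pi>1 x) (\<pi>2 x)\<close>. Evaluating \<open>P\<close> on the pairs
  \<open>{x1, x2}\<close> shows that the min-max equation is necessary. Pairs are also enough: the value of
  \<open>P\<close> on \<open>A\<close> involves only two points of \<open>A\<close>, one that maximises \<open>\<pi>1\<close> and one that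
  maximises \<open>\<pi>2\<close>, and the equation for these two exchanges minimum and maximum over the whole
  of \<open>A\<close> (\<open>min_Max_eq_Max_min\<close>).

  The statement on the natural extension is true of every possibility measure \<open>P\<close>
  (\<open>natural_extension_possibility_measure\<close>). The value \<open>P A\<close> bounds \<open>Q A\<close> for all
  \<open>Q\<close> in the credal set. It is reached by a probability with at most two atoms: for
  nonempty \<open>A\<close>, mass \<open>P A\<close> sits on a most possible point of \<open>A\<close>, and the rest on a point of possibility 1
  (\<open>two_point_mass_in_credal_set\<close>).
\<close>

lemma possibility_le_induced:
  assumes "finite A" "x \<in> A"
  shows "\<pi> x \<le> induced_possibility \<pi> A"
  using assms by (auto simp: induced_possibility_def)

lemma induced_possibility_attained:
  assumes "finite A" "A \<noteq> {}"
  obtains x where "x \<in> A" "\<pi> x = induced_possibility \<pi> A"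
proof -
  have "Max (\<pi> ` A) \<in> \<pi> ` A"
    using assms by (intro Max_in) auto
  then have "induced_possibility \<pi> A \<in> \<pi> ` A"
    using assms by (simp add: induced_possibility_def)
  then obtain x where "x \<in> A" "induced_possibility \<pi> A = \<pi> x" ..
  with that show ?thesis by simp
qed

lemma possibility_distribution_range:
  assumes "possibility_distribution X \<pi>" "x \<in> X"
  shows "0 \<le> \<pi> x" "\<pi> x \<le> 1"
  using assms by (auto simp: possibility_distribution_def)

lemma possibility_distribution_iff_induced:
  "possibility_distribution X \<pi> \<longleftrightarrow>
     X \<noteq> {} \<and> (\<forall>x\<in>X. \<pi> x \<in> {0..1}) \<and> induced_possibility \<pi> X = 1"
  by (auto simp: possibility_distribution_def induced_possibility_def)

lemma possibility_distribution_mode: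
  assumes "finite X" "possibility_distribution X \<pi>"
  obtains x where "x \<in> X" "\<pi> x = 1"
proof -
  have "X \<noteq> {}" "induced_possibility \<pi> X = 1"
    using assms(2) by (simp_all add: possibility_distribution_iff_induced)
  with induced_possibility_attained[OF assms(1), of \<pi>] that show ?thesis
    by auto
qed

lemma induced_possibility_pair:
  "induced_possibility \<pi> {x, y} = max (\<pi> x) (\<pi> y)"
  by (simp add: induced_possibility_def)

text \<open>
  The equation on pairs lets a level reached by \<open>f\<close> at one point and by \<open>g\<close> at another
  be reached by both at one of the two points. It is applied to a maximiser of \<open>f\<close> and a
  maximiser of \<open>g\<close>.
\<close>

lemma min_Max_eq_Max_min:
  fixes f g :: "'a \<Rightarrow> 'b::linorder"
  assumes A: "finite A" "A \<noteq> {}"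
    and exchange: "\<And>x y. x \<in> A \<Longrightarrow> y \<in> A \<Longrightarrow>
      min (max (f x) (f y)) (max (g x) (g y)) = max (min (f x) (g x)) (min (f y) (g y))"
  shows "min (Max (f ` A)) (Max (g ` A)) = Max ((\<lambda>x. min (f x) (g x)) ` A)"
proof (rule antisym)
  have "Max (f ` A) \<in> f ` A" "Max (g ` A) \<in> g ` A"
    using A by (intro Max_in; simp)+
  then obtain x y where x: "x \<in> A" "f x = Max (f ` A)" and y: "y \<in> A" "g y = Max (g ` A)"
    by force
  have "min (Max (f ` A)) (Max (g ` A)) \<le> min (max (f x) (f y)) (max (g x) (g y))"
    by (simp add: x y min_le_iff_disj le_max_iff_disj)
  also have "\<dots> = max (min (f x) (g x)) (min (f y) (g y))"
    using exchange x y by blast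
  also have "\<dots> \<le> Max ((\<lambda>x. min (f x) (g x)) ` A)"
    using A x(1) y(1) by (intro max.boundedI Max_ge) auto
  finally show "min (Max (f ` A)) (Max (g ` A)) \<le> Max ((\<lambda>x. min (f x) (g x)) ` A)" .
next
  show "Max ((\<lambda>x. min (f x) (g x)) ` A) \<le> min (Max (f ` A)) (Max (g ` A))"
    using A by (intro Max.boundedI) (auto intro: min.coboundedI1 min.coboundedI2)
qed

lemma min_possibility_measure_iff:
  assumes X: "finite X"
    and d1: "possibility_distribution X \<pi>1"
    and d2: "possibility_distribution X \<pi>2"
    and P: "\<And>A. A \<subseteq> X \<Longrightarrow> P A = min (induced_possibility \<pi>1 A) (induced_possibility \<pi>2 A)"
  shows "possibility_measure X P \<longleftrightarrow>
           (\<forall>x1 x2. {x1, x2} \<subseteq> X \<longrightarrow>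
              min (max (\<pi>1 x1) (\<pi>1 x2)) (max (\<pi>2 x1) (\<pi>2 x2)) =
              max (min (\<pi>1 x1) (\<pi>2 x1)) (min (\<pi>1 x2) (\<pi>2 x2)))"
    (is "_ \<longleftrightarrow> ?exchange")
proof
  assume "possibility_measure X P"
  then obtain \<pi> where \<pi>: "\<And>A. A \<subseteq> X \<Longrightarrow> P A = induced_possibility \<pi> A"
    by (auto simp: possibility_measure_def)
  have pt: "\<pi> x = min (\<pi>1 x) (\<pi>2 x)" if "x \<in> X" for x
    using \<pi>[of "{x}"] P[of "{x}"] that by (simp add: induced_possibility_def)
  show ?exchange
  proof (intro allI impI)
    fix x1 x2 assume sub: "{x1, x2} \<subseteq> X"
    have "min (max (\<pi>1 x1) (\<pi>1 x2)) (max (\<pi>2 x1) (\<pi>2 x2)) = P {x1, x2}"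
      by (simp only: P[OF sub] induced_possibility_pair)
    also have "\<dots> = max (\<pi> x1) (\<pi> x2)"
      by (simp only: \<pi>[OF sub] induced_possibility_pair)
    finally show "min (max (\<pi>1 x1) (\<pi>1 x2)) (max (\<pi>2 x1) (\<pi>2 x2)) =
        max (min (\<pi>1 x1) (\<pi>2 x1)) (min (\<pi>1 x2) (\<pi>2 x2))"
      using sub by (simp add: pt)
  qed
next
  assume ex: ?exchange
  define \<pi> where "\<pi> = (\<lambda>x. min (\<pi>1 x) (\<pi>2 x))"
  have agree: "P A = induced_possibility \<pi> A" if A: "A \<subseteq> X" for A
  proof (cases "A = {}")
    case True
    then show ?thesis using P[OF A] by (simp add: induced_possibility_def)
  next
    case False
    moreover have "min (Max (\<pi>1 ` A)) (Max (\<pi>2 ` A)) = Max (\<pi> ` A)"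
      unfolding \<pi>_def using False A ex finite_subset[OF A X]
      by (intro min_Max_eq_Max_min) auto
    ultimately show ?thesis using P[OF A] by (simp add: induced_possibility_def)
  qed
  \<comment> \<open>\<open>\<pi>\<close> reaches 1, although \<open>\<pi>1\<close> and \<open>\<pi>2\<close> may do so at different points,
      because \<open>P X = min 1 1\<close>.\<close>
  have "induced_possibility \<pi> X = 1"
    using agree[of X] P[of X] d1 d2 by (simp add: possibility_distribution_iff_induced)
  then have "possibility_distribution X \<pi>"
    using d1 possibility_distribution_range[OF d1] possibility_distribution_range[OF d2]
    by (auto simp: possibility_distribution_iff_induced \<pi>_def min_le_iff_disj)
  with agree show "possibility_measure X P"
    by (auto simp: possibility_measure_def)
qed

text \<open>
  An event \<open>B\<close> that contains \<open>z\<close> has possibility 1 and gives no constraint, and any other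
  event has mass at most \<open>c \<le> \<pi> x\<close>, and only if it contains \<open>x\<close>.
\<close>

lemma two_point_mass_in_credal_set:
  assumes X: "finite X"
    and \<pi>: "possibility_distribution X \<pi>"
    and P: "\<And>A. A \<subseteq> X \<Longrightarrow> P A = induced_possibility \<pi> A"
    and z: "z \<in> X" "\<pi> z = 1"
    and x: "x \<in> X" and c: "0 \<le> c" "c \<le> \<pi> x"
  shows "(\<lambda>B. c * of_bool (x \<in> B) + (1 - c) * of_bool (z \<in> B)) \<in> credal_set X P"
    (is "?Q \<in> _")
proof -
  have c1: "c \<le> 1"
    using c possibility_distribution_range(2)[OF \<pi> x] by simp
  have "?Q B \<le> P B" if B: "B \<subseteq> X" for B
  proof -
    have le: "\<pi> y \<le> P B" if "y \<in> B" for y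
      using possibility_le_induced[of B y \<pi>] that P[OF B] finite_subset[OF B X] by simp
    have "0 \<le> P B"
    proof (cases "B = {}")
      case True
      then show ?thesis using P[OF B] by (simp add: induced_possibility_def)
    next
      case False
      then obtain y where "y \<in> B" by blast
      then show ?thesis
        using le[of y] possibility_distribution_range(1)[OF \<pi>, of y] B by force
    qed
    then show ?thesis
      using le[of x] le[of z] z c c1 by (auto simp: of_bool_def)
  qed
  moreover have "finitely_additive_probability X ?Q"
    unfolding finitely_additive_probability_def additive_def
    using x z c c1 by (auto simp: of_bool_def)
  ultimately show ?thesis
    by (simp add: credal_set_def)
qed

lemma credal_set_attains_possibility:
  assumes X: "finite X" and P: "possibility_measure X P" and A: "A \<subseteq> X"
  shows "\<exists>Q\<in>credal_set X P. Q A = P A"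
proof -
  obtain \<pi> where \<pi>: "possibility_distribution X \<pi>"
    and ind: "\<And>A. A \<subseteq> X \<Longrightarrow> P A = induced_possibility \<pi> A"
    using P by (auto simp: possibility_measure_def)
  obtain z where z: "z \<in> X" "\<pi> z = 1"
    using possibility_distribution_mode[OF X \<pi>] .
  show ?thesis
  proof (cases "A = {}")
    case True
    \<comment> \<open>Every member of the credal set gives the empty event mass 0; one member is the
        unit mass at \<open>z\<close>, which is the case \<open>c = 0\<close>, \<open>x = z\<close>.\<close>
    have "(\<lambda>B. 0 * of_bool (z \<in> B) + (1 - 0) * of_bool (z \<in> B)) \<in> credal_set X P"
      using possibility_distribution_range(1)[OF \<pi> z(1)]
      by (intro two_point_mass_in_credal_set[OF X \<pi> ind z z(1)]) auto
    then show ?thesis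
      by (rule rev_bexI) (use True ind[OF A] in \<open>simp add: induced_possibility_def\<close>)
  next
    case False
    then obtain x where x: "x \<in> A" "\<pi> x = P A"
      using induced_possibility_attained[OF finite_subset[OF A X], of \<pi>] ind[OF A] by auto
    with A have xX: "x \<in> X" by blast
    let ?Q = "\<lambda>B. \<pi> x * of_bool (x \<in> B) + (1 - \<pi> x) * of_bool (z \<in> B)"
    have Q: "?Q \<in> credal_set X P"
      using possibility_distribution_range(1)[OF \<pi> xX]
      by (intro two_point_mass_in_credal_set[OF X \<pi> ind z xX]) auto
    \<comment> \<open>If \<open>z\<close> lies in \<open>A\<close> as well, then domination by \<open>P\<close> rules out any mass in excess
        of \<open>\<pi> x = P A\<close>.\<close>
    have "?Q A \<le> P A"
      using Q A by (simp add: credal_set_def)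
    moreover have "P A \<le> ?Q A"
      using x possibility_distribution_range(2)[OF \<pi> xX] by simp
    ultimately have "?Q A = P A" by simp
    with Q show ?thesis by (intro bexI[of _ ?Q])
  qed
qed

lemma natural_extension_possibility_measure:
  assumes X: "finite X" and P: "possibility_measure X P"
  shows "avoids_sure_loss X P"
    and "A \<subseteq> X \<Longrightarrow> natural_extension X P A = P A"
    and "possibility_measure X (natural_extension X P)"
proof -
  show "avoids_sure_loss X P"
    using credal_set_attains_possibility[OF X P, of "{}"] by (auto simp: avoids_sure_loss_def)
  have ext: "natural_extension X P A = P A" if A: "A \<subseteq> X" for A
    unfolding natural_extension_def
  proof (rule Greatest_equality)
    show "P A \<in> (\<lambda>Q. Q A) ` credal_set X P"
      using credal_set_attains_possibility[OF X P A] by (metis imageI)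
    show "r \<le> P A" if "r \<in> (\<lambda>Q. Q A) ` credal_set X P" for r
      using that A by (auto simp: credal_set_def)
  qed
  then show "A \<subseteq> X \<Longrightarrow> natural_extension X P A = P A" .
  show "possibility_measure X (natural_extension X P)"
    using P ext by (simp add: possibility_measure_def)
qed

theorem theorem16:
  fixes X :: "'a set" and \<pi>1 \<pi>2 :: "'a \<Rightarrow> real" and P :: "'a set \<Rightarrow> real"
  assumes "finite X"
    and "possibility_distribution X \<pi>1"
    and "possibility_distribution X \<pi>2"
    and "\<And>A. A \<subseteq> X \<Longrightarrow> P A = min (induced_possibility \<pi>1 A) (induced_possibility \<pi>2 A)"
  shows "(possibility_measure X P \<longleftrightarrow>
           (\<forall>x1 x2. {x1, x2} \<subseteq> X \<longrightarrow>
              min (max (\<pi>1 x1) (\<pi>1 x2)) (max (\<pi>2 x1) (\<pi>2 x2)) =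
              max (min (\<pi>1 x1) (\<pi>2 x1)) (min (\<pi>1 x2) (\<pi>2 x2)))) \<and>
         (possibility_measure X P \<longrightarrow>
            avoids_sure_loss X P \<and>
            (\<forall>A\<subseteq>X. natural_extension X P A = P A) \<and>
            possibility_measure X (natural_extension X P))"
proof (intro conjI impI allI)
  show "possibility_measure X P \<longleftrightarrow>
           (\<forall>x1 x2. {x1, x2} \<subseteq> X \<longrightarrow>
              min (max (\<pi>1 x1) (\<pi>1 x2)) (max (\<pi>2 x1) (\<pi>2 x2)) =
              max (min (\<pi>1 x1) (\<pi>2 x1)) (min (\<pi>1 x2) (\<pi>2 x2)))"
    using assms by (rule min_possibility_measure_iff)
qed (use natural_extension_possibility_measure[OF assms(1)] in simp_all)

end
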